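(* Let $\alpha>0$, let $\mathrm{f}$ be an error function, and let $\boldsymbol{\mathcal R}\subseteq 2^{[m]}$ be a random collection of rejection sets. Then $\boldsymbol{\mathcal R}$ controls $\mathrm{ER}_{\mathrm f}$ simultaneously at level $\alpha$, i.e. $\mathbb E_{\mathrm P}\big(\max_{R\in\boldsymbol{\mathcal R}}\mathrm f_{N_{\mathrm P}}(R)\big)\le\alpha$ for every $\mathrm P\in M$, if and only if there exists an e-collection $\mathbf E=(\mathbf e_S)_{S\in 2^{[m]}}$ such that $\boldsymbol{\mathcal R}\subseteq \mathcal R^{\mathrm{ER}_{\mathrm f}}_\alpha(\mathbf E)$, where $$\mathcal R^{\mathrm{ER}_{\mathrm f}}_\alpha(\mathbf E)=\Big\{R\in 2^{[m]}:\ \mathbf e_S\ge \frac{\mathrm f_S(R)}{\alpha}\ \text{ for all } S\in 2^{[m]}\Big\}.$$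
   Context: Setting: $M$ is a set of probability measures on a measurable space; $m\ge 1$, $[m]=\{1,\dots,m\}$; hypotheses $H_1,\dots,H_m$ are subsets of $M$; for $\mathrm P\in M$, $N_{\mathrm P}=\{i\in[m]:\mathrm P\in H_i\}$. Random variables, random sets (values in $2^{[m]}$) and random collections (values in $2^{2^{[m]}}$) are measurable functions on this space; inequalities and inclusions between random objects are understood to hold $\mathrm P$-almost surely for every $\mathrm P\in M$. An error function $\mathrm f$ assigns to each pair $N,R\in 2^{[m]}$ a number $\mathrm f_N(R)\in[0,\infty)$, with $\mathrm f_N(\emptyset)=0$ for all $N$ and $\mathrm f_\emptyset(R)=0$ for all $R$. Random collections $\boldsymbol{\mathcal R}$ are assumed to be never empty (without loss, since $\emptyset$ may always be added to them). An e-collection is a family $\mathbf E=(\mathbf e_S)_{S\in 2^{[m]}}$ of nonnegative random variables with $\mathbb E_{\mathrm P}(\mathbf e_{N_{\mathrm P}})\le 1$ for all $\mathrm P\in M$; by convention $\mathbf e_\emptyset=0$. *)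

theory Defs
  imports "HOL-Probability.Probability"
begin

text \<open>
  The measurable space is represented by a measure \<open>\<Omega>\<close> of which only \<open>space \<Omega>\<close> and \<open>sets \<Omega>\<close>
  matter. \<open>space (prob_algebra \<Omega>)\<close> is the set of all probability measures on it.
\<close>

definition testing_problem ::
  "nat \<Rightarrow> 'a measure \<Rightarrow> 'a measure set \<Rightarrow> (nat \<Rightarrow> 'a measure set) \<Rightarrow> bool" where
  "testing_problem m \<Omega> M H \<longleftrightarrow>
     1 \<le> m \<and> M \<subseteq> space (prob_algebra \<Omega>) \<and> (\<forall>i\<in>{1..m}. H i \<subseteq> M)"

definition true_hyps :: "nat \<Rightarrow> (nat \<Rightarrow> 'a measure set) \<Rightarrow> 'a measure \<Rightarrow> nat set" where
  "true_hyps m H P = {i\<in>{1..m}. P \<in> H i}"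

definition error_function :: "nat \<Rightarrow> (nat set \<Rightarrow> nat set \<Rightarrow> real) \<Rightarrow> bool" where
  "error_function m f \<longleftrightarrow>
     (\<forall>N\<in>Pow {1..m}. \<forall>R\<in>Pow {1..m}. 0 \<le> f N R) \<and>
     (\<forall>N\<in>Pow {1..m}. f N {} = 0) \<and>
     (\<forall>R\<in>Pow {1..m}. f {} R = 0)"

definition random_collection :: "nat \<Rightarrow> 'a measure \<Rightarrow> ('a \<Rightarrow> nat set set) \<Rightarrow> bool" where
  "random_collection m \<Omega> \<R> \<longleftrightarrow>
     \<R> \<in> measurable \<Omega> (count_space (Pow (Pow {1..m}))) \<and> (\<forall>\<omega>\<in>space \<Omega>. \<R> \<omega> \<noteq> {})"

text \<open>
  Inequalities and inclusions between random objects are read as holding \<open>P\<close>-almost surely for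
  every \<open>P \<in> M\<close>; this includes nonnegativity of the e-values. Expectations of nonnegative variables
  are nonnegative Lebesgue integrals, so that they are always meaningful, possibly infinite.
\<close>

definition e_collection ::
  "nat \<Rightarrow> 'a measure \<Rightarrow> 'a measure set \<Rightarrow> (nat \<Rightarrow> 'a measure set) \<Rightarrow> (nat set \<Rightarrow> 'a \<Rightarrow> real) \<Rightarrow> bool"
  where
  "e_collection m \<Omega> M H e \<longleftrightarrow>
     (\<forall>S\<in>Pow {1..m}. e S \<in> borel_measurable \<Omega> \<and> (\<forall>P\<in>M. AE \<omega> in P. 0 \<le> e S \<omega>)) \<and>
     (\<forall>\<omega>\<in>space \<Omega>. e {} \<omega> = 0) \<and>
     (\<forall>P\<in>M. (\<integral>\<^sup>+\<omega>. ennreal (e (true_hyps m H P) \<omega>) \<partial>P) \<le> 1)"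

definition controls_ER ::
  "nat \<Rightarrow> 'a measure set \<Rightarrow> (nat \<Rightarrow> 'a measure set) \<Rightarrow> (nat set \<Rightarrow> nat set \<Rightarrow> real) \<Rightarrow> real \<Rightarrow>
     ('a \<Rightarrow> nat set set) \<Rightarrow> bool" where
  "controls_ER m M H f \<alpha> \<R> \<longleftrightarrow>
     (\<forall>P\<in>M. (\<integral>\<^sup>+\<omega>. ennreal (MAX R\<in>\<R> \<omega>. f (true_hyps m H P) R) \<partial>P) \<le> ennreal \<alpha>)"

definition closed_collection ::
  "nat \<Rightarrow> (nat set \<Rightarrow> nat set \<Rightarrow> real) \<Rightarrow> real \<Rightarrow> (nat set \<Rightarrow> 'a \<Rightarrow> real) \<Rightarrow> 'a \<Rightarrow> nat set set" where
  "closed_collection m f \<alpha> e \<omega> =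
     {R\<in>Pow {1..m}. \<forall>S\<in>Pow {1..m}. e S \<omega> \<ge> f S R / \<alpha>}"

end

theory Submission
  imports Defs
begin

text \<open>
  The smallest e-values that make a given collection admissible are
  \<open>e S = (MAX R\<in>\<R>. f S R) / \<alpha>\<close>, and simultaneous control at level \<open>\<alpha>\<close> says exactly
  that these form an e-collection.
\<close>

lemma true_hyps_subset: "true_hyps m H P \<in> Pow {1..m}"
  by (auto simp: true_hyps_def)

lemma random_collectionD:
  assumes "random_collection m \<Omega> \<R>" "\<omega> \<in> space \<Omega>"
  shows "\<R> \<omega> \<subseteq> Pow {1..m}" "\<R> \<omega> \<noteq> {}" "finite (\<R> \<omega>)"
proof -
  show "\<R> \<omega> \<subseteq> Pow {1..m}"
    using measurable_space[of \<R> \<Omega> "count_space (Pow (Pow {1..m}))" \<omega>] assms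
    by (simp add: random_collection_def)
  then show "finite (\<R> \<omega>)"
    by (rule finite_subset) simp
  show "\<R> \<omega> \<noteq> {}"
    using assms by (simp add: random_collection_def)
qed

text \<open>\<open>Max\<close> is a genuine maximum only on finite nonempty sets. A random
  collection supplies both properties at every point of \<Omega>.\<close>

lemma random_collection_Max_le_iff:
  fixes g :: "nat set \<Rightarrow> real"
  assumes "random_collection m \<Omega> \<R>" "\<omega> \<in> space \<Omega>"
  shows "(MAX R\<in>\<R> \<omega>. g R) \<le> c \<longleftrightarrow> (\<forall>R\<in>\<R> \<omega>. g R \<le> c)"
  using random_collectionD[OF assms] by (subst Max_le_iff) auto

text \<open>The collection takes values in a discrete space, on which every real function is
  measurable. The maximum is therefore a measurable function composed with \<R>, and nothing is
  asked of \<open>g\<close>.\<close>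

lemma borel_measurable_random_collection_Max:
  fixes g :: "nat set \<Rightarrow> real"
  assumes "random_collection m \<Omega> \<R>"
  shows "(\<lambda>\<omega>. MAX R\<in>\<R> \<omega>. g R) \<in> borel_measurable \<Omega>"
proof (rule measurable_compose[where g = "\<lambda>\<A>. MAX R\<in>\<A>. g R"])
  show "\<R> \<in> measurable \<Omega> (count_space (Pow (Pow {1..m})))"
    using assms by (simp add: random_collection_def)
qed simp

text \<open>Collections and e-values are measurable over \<Omega>, while expectations and almost
  sure statements are taken under P. These equations carry facts from one to the other.\<close>

lemma testing_problem_space_sets:
  assumes "testing_problem m \<Omega> M H" "P \<in> M"
  shows "space P = space \<Omega>" "sets P = sets \<Omega>"
proof -
  show "sets P = sets \<Omega>"
    using assms by (auto simp: testing_problem_def space_prob_algebra)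
  then show "space P = space \<Omega>"
    by (rule sets_eq_imp_space_eq)
qed

text \<open>Membership in the closed collection is applied at \<open>S = true_hyps m H P\<close>,
  the index whose e-value has expectation at most 1 under P. There it bounds every error in \<R>
  \<omega>, hence their maximum, by \<alpha> times that e-value. Integrating gives the bound
  \<alpha>.\<close>

lemma closed_collection_superset_imp_controls_ER:
  assumes tp: "testing_problem m \<Omega> M H" and \<alpha>: "0 < \<alpha>"
    and rc: "random_collection m \<Omega> \<R>" and e: "e_collection m \<Omega> M H e"
    and sub: "\<forall>P\<in>M. AE \<omega> in P. \<R> \<omega> \<subseteq> closed_collection m f \<alpha> e \<omega>"
  shows "controls_ER m M H f \<alpha> \<R>"
  unfolding controls_ER_def
proof
  fix P assume P: "P \<in> M"
  note space_P = testing_problem_space_sets(1)[OF tp P]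
  let ?N = "true_hyps m H P"
  have "e ?N \<in> borel_measurable \<Omega>"
    using e true_hyps_subset unfolding e_collection_def by blast
  then have [measurable]: "e ?N \<in> borel_measurable P"
    by (simp only: measurable_cong_sets[OF testing_problem_space_sets(2)[OF tp P] refl])
  have "AE \<omega> in P. \<R> \<omega> \<subseteq> closed_collection m f \<alpha> e \<omega>"
    using sub P by blast
  then have "AE \<omega> in P. (MAX R\<in>\<R> \<omega>. f ?N R) \<le> \<alpha> * e ?N \<omega>"
  proof (rule AE_mp, intro AE_I2 impI)
    fix \<omega> assume \<omega>: "\<omega> \<in> space P" and "\<R> \<omega> \<subseteq> closed_collection m f \<alpha> e \<omega>"
    then have "\<forall>R\<in>\<R> \<omega>. f ?N R / \<alpha> \<le> e ?N \<omega>"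
      using true_hyps_subset unfolding closed_collection_def by blast
    then have "\<forall>R\<in>\<R> \<omega>. f ?N R \<le> \<alpha> * e ?N \<omega>"
      using \<alpha> by (simp add: pos_divide_le_eq mult.commute)
    then show "(MAX R\<in>\<R> \<omega>. f ?N R) \<le> \<alpha> * e ?N \<omega>"
      using random_collection_Max_le_iff[OF rc] \<omega> space_P by simp
  qed
  then have "(\<integral>\<^sup>+\<omega>. ennreal (MAX R\<in>\<R> \<omega>. f ?N R) \<partial>P) \<le> (\<integral>\<^sup>+\<omega>. ennreal \<alpha> * ennreal (e ?N \<omega>) \<partial>P)"
  proof (intro nn_integral_mono_AE, elim eventually_mono)
    fix \<omega> assume "(MAX R\<in>\<R> \<omega>. f ?N R) \<le> \<alpha> * e ?N \<omega>"
    \<comment> \<open>\<open>ennreal\<close> sends negative reals to 0, so it commutes with the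
      nonnegative factor \<alpha> whatever the sign of \<open>e ?N \<omega>\<close>.\<close>
    then show "ennreal (MAX R\<in>\<R> \<omega>. f ?N R) \<le> ennreal \<alpha> * ennreal (e ?N \<omega>)"
      using \<alpha> by (simp add: ennreal_mult'[symmetric] ennreal_leI)
  qed
  also have "\<dots> = ennreal \<alpha> * (\<integral>\<^sup>+\<omega>. ennreal (e ?N \<omega>) \<partial>P)"
    by (rule nn_integral_cmult) measurable
  also have "\<dots> \<le> ennreal \<alpha> * 1"
    using e P by (intro mult_left_mono) (auto simp: e_collection_def)
  finally show "(\<integral>\<^sup>+\<omega>. ennreal (MAX R\<in>\<R> \<omega>. f ?N R) \<partial>P) \<le> ennreal \<alpha>"
    by simp
qed

text \<open>Dividing by \<alpha> rescales the bound \<alpha> on the expected maximal error to the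
  bound 1 required of an e-value. The other two conditions come from \<open>f\<close>: errors are
  nonnegative, and they vanish when no hypothesis is true.\<close>

lemma e_collection_Max:
  assumes tp: "testing_problem m \<Omega> M H" and \<alpha>: "0 < \<alpha>" and f: "error_function m f"
    and rc: "random_collection m \<Omega> \<R>" and ctrl: "controls_ER m M H f \<alpha> \<R>"
  shows "e_collection m \<Omega> M H (\<lambda>S \<omega>. (MAX R\<in>\<R> \<omega>. f S R) / \<alpha>)"
  unfolding e_collection_def
proof (intro conjI ballI)
  fix S assume S: "S \<in> Pow {1..m}"
  show "(\<lambda>\<omega>. (MAX R\<in>\<R> \<omega>. f S R) / \<alpha>) \<in> borel_measurable \<Omega>"
    by (intro borel_measurable_divide borel_measurable_const
        borel_measurable_random_collection_Max[OF rc])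
  fix P assume P: "P \<in> M"
  show "AE \<omega> in P. 0 \<le> (MAX R\<in>\<R> \<omega>. f S R) / \<alpha>"
  proof (rule AE_I2)
    fix \<omega> assume "\<omega> \<in> space P"
    then have \<omega>: "\<omega> \<in> space \<Omega>"
      using testing_problem_space_sets(1)[OF tp P] by simp
    note \<R> = random_collectionD[OF rc \<omega>]
    \<comment> \<open>Nonemptiness provides one rejection set, whose nonnegative error bounds the
      maximum from below.\<close>
    then obtain R where "R \<in> \<R> \<omega>" "R \<in> Pow {1..m}"
      by blast
    then have "0 \<le> f S R" "f S R \<le> (MAX R\<in>\<R> \<omega>. f S R)"
      using f S \<R>(3) by (auto simp: error_function_def)
    then show "0 \<le> (MAX R\<in>\<R> \<omega>. f S R) / \<alpha>"
      using \<alpha> by simp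
  qed
next
  fix \<omega> assume "\<omega> \<in> space \<Omega>"
  note \<R> = random_collectionD[OF rc this]
  have "f {} R = 0" if "R \<in> \<R> \<omega>" for R
    using f \<R>(1) that unfolding error_function_def by blast
  \<comment> \<open>Nonemptiness makes this image a singleton and not the empty set, on which
    \<open>Max\<close> has no useful value.\<close>
  then have "f {} ` \<R> \<omega> = {0}"
    using \<R>(2) by force
  then show "(MAX R\<in>\<R> \<omega>. f {} R) / \<alpha> = 0"
    by simp
next
  fix P assume P: "P \<in> M"
  let ?N = "true_hyps m H P"
  have [measurable]: "(\<lambda>\<omega>. MAX R\<in>\<R> \<omega>. f ?N R) \<in> borel_measurable P"
    using borel_measurable_random_collection_Max[OF rc]
    by (simp only: measurable_cong_sets[OF testing_problem_space_sets(2)[OF tp P] refl])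
  have "(\<integral>\<^sup>+\<omega>. ennreal ((MAX R\<in>\<R> \<omega>. f ?N R) / \<alpha>) \<partial>P)
      = (\<integral>\<^sup>+\<omega>. ennreal (1 / \<alpha>) * ennreal (MAX R\<in>\<R> \<omega>. f ?N R) \<partial>P)"
    using \<alpha> by (simp add: ennreal_mult'[symmetric])
  also have "\<dots> = ennreal (1 / \<alpha>) * (\<integral>\<^sup>+\<omega>. ennreal (MAX R\<in>\<R> \<omega>. f ?N R) \<partial>P)"
    by (rule nn_integral_cmult) measurable
  also have "\<dots> \<le> ennreal (1 / \<alpha>) * ennreal \<alpha>"
    using ctrl P by (intro mult_left_mono) (auto simp: controls_ER_def)
  also have "\<dots> = 1"
    using \<alpha> by (simp add: ennreal_mult'[symmetric])
  finally show "(\<integral>\<^sup>+\<omega>. ennreal ((MAX R\<in>\<R> \<omega>. f ?N R) / \<alpha>) \<partial>P) \<le> 1" .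
qed

text \<open>Each member of \<R> \<omega> competes in the maximum, so its error is dominated for
  every \<open>S\<close> at once. The inclusion holds at every point of \<Omega>, and almost sure
  inclusion under each P follows.\<close>

lemma random_collection_subset_closed_collection_Max:
  assumes rc: "random_collection m \<Omega> \<R>" and \<omega>: "\<omega> \<in> space \<Omega>" and \<alpha>: "0 < \<alpha>"
  shows "\<R> \<omega> \<subseteq> closed_collection m f \<alpha> (\<lambda>S \<omega>. (MAX R\<in>\<R> \<omega>. f S R) / \<alpha>) \<omega>"
proof
  fix R assume "R \<in> \<R> \<omega>"
  then have "R \<in> Pow {1..m}" "f S R / \<alpha> \<le> (MAX R\<in>\<R> \<omega>. f S R) / \<alpha>" for S
    using random_collectionD(1,3)[OF rc \<omega>] \<alpha> by (blast, simp add: divide_right_mono)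
  then show "R \<in> closed_collection m f \<alpha> (\<lambda>S \<omega>. (MAX R\<in>\<R> \<omega>. f S R) / \<alpha>) \<omega>"
    unfolding closed_collection_def by blast
qed

theorem theorem6:
  fixes m :: nat and \<Omega> :: "'a measure" and M :: "'a measure set"
    and H :: "nat \<Rightarrow> 'a measure set" and f :: "nat set \<Rightarrow> nat set \<Rightarrow> real"
    and \<alpha> :: real and \<R> :: "'a \<Rightarrow> nat set set"
  assumes "testing_problem m \<Omega> M H"
    and "0 < \<alpha>"
    and "error_function m f"
    and "random_collection m \<Omega> \<R>"
  shows "controls_ER m M H f \<alpha> \<R> \<longleftrightarrow>
    (\<exists>e. e_collection m \<Omega> M H e \<and>
      (\<forall>P\<in>M. AE \<omega> in P. \<R> \<omega> \<subseteq> closed_collection m f \<alpha> e \<omega>))"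
proof
  assume "controls_ER m M H f \<alpha> \<R>"
  then have "e_collection m \<Omega> M H (\<lambda>S \<omega>. (MAX R\<in>\<R> \<omega>. f S R) / \<alpha>)"
    using assms by (intro e_collection_Max)
  moreover have "\<forall>P\<in>M. AE \<omega> in P.
      \<R> \<omega> \<subseteq> closed_collection m f \<alpha> (\<lambda>S \<omega>. (MAX R\<in>\<R> \<omega>. f S R) / \<alpha>) \<omega>"
    using testing_problem_space_sets(1)[OF assms(1)] assms(2,4)
    by (intro ballI AE_I2 random_collection_subset_closed_collection_Max) auto
  ultimately show "\<exists>e. e_collection m \<Omega> M H e \<and>
      (\<forall>P\<in>M. AE \<omega> in P. \<R> \<omega> \<subseteq> closed_collection m f \<alpha> e \<omega>)"
    by (intro exI conjI)
next
  assume "\<exists>e. e_collection m \<Omega> M H e \<and>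
      (\<forall>P\<in>M. AE \<omega> in P. \<R> \<omega> \<subseteq> closed_collection m f \<alpha> e \<omega>)"
  then show "controls_ER m M H f \<alpha> \<R>"
    using assms closed_collection_superset_imp_controls_ER by blast
qed

end
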